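(* For every complex number $q$ with $|q|<1$, $$\begin{aligned} &\varphi(-q^2)\varphi(-q^6)\varphi(q^{21})-2q^3\,\varphi(-q^2)\,f(-q^2,-q^{10})\,f(q^7,q^{35})\\ &=\varphi(-q^7)^2\,\varphi(q^7)-2q^2 f(-q^3,-q^{11})f(-q,-q^{13})f(q^5,q^9)\\ &\quad+2q^2 f(-q^5,-q^9)f(-q,-q^{13})f(q^3,q^{11})-2q^2 f(-q^5,-q^9)f(-q^3,-q^{11})f(q,q^{13}). \end{aligned}$$
   Context: Ramanujan's general theta function is $f(a,b):=\sum_{n=-\infty}^{\infty}a^{n(n+1)/2}b^{n(n-1)/2}$ for $|ab|<1$, and $\varphi(q):=f(q,q)=\sum_{n=-\infty}^{\infty}q^{n^2}$ for $|q|<1$. The notation $\varphi(-q^7)^2$ means $(\varphi(-q^7))^2$. The convention $0^0=1$ is used when $q=0$. *)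

theory Defs
  imports "HOL-Analysis.Analysis"
begin

text \<open>Ramanujan's general theta function. The exponents \<open>n(n+1)/2\<close> and \<open>n(n-1)/2\<close> are
  non-negative integers for every integer \<open>n\<close>, so \<open>div\<close> and \<open>nat\<close> lose nothing here.
  The definition is meaningful for \<open>norm (a * b) < 1\<close>, where the series converges absolutely.\<close>

definition ramanujan_f :: "complex \<Rightarrow> complex \<Rightarrow> complex" where
  "ramanujan_f a b =
     (\<Sum>\<^sub>\<infinity>n\<in>(UNIV :: int set). a ^ nat (n * (n + 1) div 2) * b ^ nat (n * (n - 1) div 2))"

definition ramanujan_phi :: "complex \<Rightarrow> complex" where
  "ramanujan_phi q = ramanujan_f q q"

lemma ramanujan_phi_eq_infsum:
  "ramanujan_phi q = (\<Sum>\<^sub>\<infinity>n\<in>(UNIV :: int set). q ^ nat (n\<^sup>2))"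
proof -
  have "q ^ nat (n * (n + 1) div 2) * q ^ nat (n * (n - 1) div 2) = q ^ nat (n\<^sup>2)" for n :: int
  proof -
    have "even (n * (n + 1))" "even (n * (n - 1))"
      by auto
    then have "n * (n + 1) div 2 + n * (n - 1) div 2 = (n * (n + 1) + n * (n - 1)) div 2"
      by (simp add: div_add)
    also have "\<dots> = n\<^sup>2"
      by (simp add: algebra_simps power2_eq_square)
    finally have sum_eq: "n * (n + 1) div 2 + n * (n - 1) div 2 = n\<^sup>2" .
    have "n * (n + 1) \<ge> 0" "n * (n - 1) \<ge> 0"
      by (auto simp: zero_le_mult_iff)
    then have "nat (n * (n + 1) div 2) + nat (n * (n - 1) div 2) = nat (n\<^sup>2)"
      unfolding sum_eq [symmetric] by (subst nat_add_distrib) auto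
    then show ?thesis
      by (metis power_add)
  qed
  then show ?thesis
    by (simp add: ramanujan_phi_def ramanujan_f_def)
qed

end

theory Submission
  imports Defs
begin

text \<open>
  Consider the sum over \<open>\<int>\<^sup>3\<close> of \<open>q\<close> to the power \<open>2x\<^sup>2 + 2y\<^sup>2 + 3z\<^sup>2 - 2xy - 2xz\<close>, with the sign of
  the parity of \<open>x + y + z\<close>. The exponent is \<open>(X\<^sup>2 + Y\<^sup>2 + Z\<^sup>2) / 7\<close> on the lattice of integer
  vectors congruent modulo 7 to a multiple of \<open>(1, 2, 3)\<close>, in the basis \<open>(1, 2, 3)\<close>,
  \<open>(2, -3, -1)\<close>, \<open>(1, 2, -4)\<close>; the seven residue classes of that lattice modulo 7 give the
  right-hand side. Where \<open>y + z\<close> is even, the exponent is \<open>2u\<^sup>2 + (2B\<^sup>2 + 7C\<^sup>2) / 3\<close> with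
  \<open>u = x - (y + z) / 2\<close>, \<open>B = (3y - z) / 2\<close>, \<open>C = z\<close>, so that \<open>B\<close> and \<open>C\<close> are congruent modulo 3,
  and the three residue classes give the left-hand side. The terms with \<open>y + z\<close> odd cancel in
  pairs: the reflection in the first basis vector replaces \<open>x\<close> by \<open>y + z - x\<close>, which preserves
  the exponent and changes the sign.
\<close>

section \<open>Unconditional sums over products and over the integers\<close>

text \<open>Summability of complex families is absolute, so the norms of the products are summable
  on the whole product set, and the iterated sum can be read as a sum over pairs.\<close>

lemma has_sum_mult_Times:
  fixes f :: "'a \<Rightarrow> complex" and g :: "'b \<Rightarrow> complex"
  assumes f: "(f has_sum a) A" and g: "(g has_sum b) B"
  shows "((\<lambda>(x, y). f x * g y) has_sum (a * b)) (A \<times> B)"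
proof (rule has_sum_SigmaI)
  show "((\<lambda>y. case (x, y) of (x, y) \<Rightarrow> f x * g y) has_sum (f x * b)) B" for x
    using has_sum_cmult_right[OF g] by simp
  show "((\<lambda>x. f x * b) has_sum (a * b)) A"
    by (rule has_sum_cmult_left[OF f])
  have "(\<lambda>x. norm (f x)) summable_on A" "(\<lambda>y. norm (g y)) summable_on B"
    using f g summable_on_iff_abs_summable_on_complex has_sum_imp_summable by blast+
  then have "(\<lambda>p. norm (case p of (x, y) \<Rightarrow> f x * g y)) summable_on A \<times> B"
    unfolding Infinite_Sum.abs_summable_on_Sigma_iff
    by (auto simp: norm_mult infsum_cmult_right' abs_mult
        intro!: summable_on_cmult_right summable_on_cmult_left)
  then show "(\<lambda>(x, y). f x * g y) summable_on A \<times> B"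
    by (rule Infinite_Sum.abs_summable_summable)
qed

lemma summable_on_power_nat_abs:
  fixes r :: real
  assumes "0 \<le> r" "r < 1"
  shows "(\<lambda>n :: int. r ^ nat \<bar>n\<bar>) summable_on UNIV"
proof -
  have s: "(\<lambda>n. r ^ n) summable_on (UNIV :: nat set)"
    using assms by (intro norm_summable_imp_summable_on) (auto simp: norm_power summable_geometric)
  have "(\<lambda>n :: int. r ^ nat \<bar>n\<bar>) summable_on range int"
    by (subst summable_on_reindex) (auto simp: o_def s)
  moreover have "(\<lambda>n :: int. r ^ nat \<bar>n\<bar>) summable_on range (\<lambda>n. - int n)"
    by (subst summable_on_reindex) (auto simp: o_def s inj_on_def)
  ultimately have "(\<lambda>n :: int. r ^ nat \<bar>n\<bar>) summable_on (range int \<union> range (\<lambda>n. - int n))"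
    by (rule summable_on_union)
  moreover have "range int \<union> range (\<lambda>n. - int n) = UNIV"
    by (auto simp: image_iff) (metis int_cases2)
  ultimately show ?thesis by simp
qed

section \<open>Theta series in one variable\<close>

text \<open>General term of f(s q^(m+k), s q^(m-k)) for a sign s. Integer exponents allow completing
  squares by plain ring identities.\<close>

definition theta_term :: "complex \<Rightarrow> complex \<Rightarrow> int \<Rightarrow> int \<Rightarrow> int \<Rightarrow> complex" where
  "theta_term q s m k n = s powi n * q powi (m * n\<^sup>2 + k * n)"

text \<open>For integers, |k| < m means |k| <= m - 1, and |n| <= n^2; hence the exponent is at least
  |n|, and a two-sided geometric series dominates.\<close>

lemma theta_term_summable:
  assumes "norm q < 1" "q \<noteq> 0" "norm s = 1" "\<bar>k\<bar> < m"
  shows "theta_term q s m k summable_on UNIV"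
proof (rule Infinite_Sum.abs_summable_summable, rule Infinite_Sum.abs_summable_on_comparison_test')
  show "(\<lambda>n :: int. norm q ^ nat \<bar>n\<bar>) summable_on UNIV"
    using assms by (intro summable_on_power_nat_abs) auto
  show "norm (theta_term q s m k n) \<le> norm q ^ nat \<bar>n\<bar>" for n
  proof -
    have "\<bar>n\<bar> \<le> m * n\<^sup>2 + k * n"
    proof (cases "n = 0")
      case False
      have "\<bar>k * n\<bar> \<le> (m - 1) * \<bar>n\<bar>"
        using assms(4) by (auto simp: abs_mult intro!: mult_right_mono)
      moreover have "\<bar>n\<bar> * 1 \<le> \<bar>n\<bar> * \<bar>n\<bar>"
        using False by (intro mult_left_mono) auto
      then have "m * \<bar>n\<bar> \<le> m * n\<^sup>2"
        using assms(4) by (intro mult_left_mono) (auto simp: power2_eq_square)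
      ultimately show ?thesis by (simp add: algebra_simps)
    qed auto
    then have "norm q powi (m * n\<^sup>2 + k * n) \<le> norm q powi \<bar>n\<bar>"
      using assms by (intro power_int_decreasing) auto
    also have "\<dots> = norm q ^ nat \<bar>n\<bar>"
      by (simp add: power_int_def)
    finally show ?thesis
      using assms by (simp add: theta_term_def norm_mult norm_power_int)
  qed
qed

lemma sign_power_int_cong:
  fixes s :: "'a :: field"
  assumes "s = 1 \<or> s = - 1" "even (a - b)"
  shows "s powi a = s powi b"
  using assms by (auto simp: power_int_minus_left)

text \<open>The two exponents are t and t - n with 2t = n(n + 1). Their sum n^2 has the parity of n,
  which leaves the sign s^n.\<close>

lemma ramanujan_f_term:
  fixes q s :: complex and i j :: nat
  assumes "q \<noteq> 0" "s = 1 \<or> s = - 1" "int i + int j = 2 * m" "int i - int j = 2 * k"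
  shows "(s * q ^ i) ^ nat (n * (n + 1) div 2) * (s * q ^ j) ^ nat (n * (n - 1) div 2)
    = theta_term q s m k n"
proof -
  obtain t where t: "n * (n + 1) = 2 * t"
    by (metis dvd_def even_mult_iff even_plus_one_iff)
  have t': "n * (n - 1) = 2 * (t - n)"
    using t by (simp add: algebra_simps)
  have "0 \<le> n * (n + 1)" "0 \<le> n * (n - 1)"
    by (auto simp: zero_le_mult_iff)
  then have nonneg: "0 \<le> t" "0 \<le> t - n"
    unfolding t t' by auto
  have m: "m = int j + k" and i: "int i = int j + 2 * k"
    using assms(3,4) by auto
  have tt: "2 * t = n\<^sup>2 + n"
    using t by (simp add: power2_eq_square algebra_simps)
  have e: "int i * t + int j * (t - n) = m * n\<^sup>2 + k * n"
  proof -
    have "2 * (int i * t + int j * (t - n)) = int i * (2 * t) + int j * (2 * t - 2 * n)"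
      by (simp add: algebra_simps)
    also have "\<dots> = 2 * (m * n\<^sup>2 + k * n)"
      unfolding tt m i by (simp add: algebra_simps)
    finally show ?thesis by simp
  qed
  have "s \<noteq> 0" using assms(2) by auto
  have "(s * q ^ i) ^ nat (n * (n + 1) div 2) * (s * q ^ j) ^ nat (n * (n - 1) div 2)
    = (s * q powi i) powi t * (s * q powi j) powi (t - n)"
    unfolding t t' using nonneg by (simp add: power_int_def)
  also have "\<dots> = (s powi t * s powi (t - n)) * (q powi (int i * t) * q powi (int j * (t - n)))"
    unfolding power_int_mult_distrib power_int_mult by (simp only: mult_ac)
  also have "\<dots> = s powi (t + (t - n)) * q powi (m * n\<^sup>2 + k * n)"
    unfolding e [symmetric] using assms(1) \<open>s \<noteq> 0\<close> by (simp only: power_int_add simp_thms)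
  also have "s powi (t + (t - n)) = s powi n"
    using assms(2) by (rule sign_power_int_cong) auto
  finally show ?thesis by (simp add: theta_term_def)
qed

lemma theta_term_reflect:
  assumes "s = 1 \<or> s = - 1"
  shows "theta_term q s m (- k) (- n) = theta_term q s m k n"
  using sign_power_int_cong[OF assms, of "- n" n] by (simp add: theta_term_def)

text \<open>Both signs of \<open>k\<close> are covered because n -> -n exchanges the arguments of f;
  opposite residue classes of the lattice produce both signs.\<close>

lemma theta_term_has_sum:
  fixes i j :: nat
  assumes q: "norm q < 1" "q \<noteq> 0" and s: "s = 1 \<or> s = - 1" and "0 < i" "0 < j"
    and m: "int i + int j = 2 * m" and k: "int i - int j = 2 * k \<or> int j - int i = 2 * k"
  shows "(theta_term q s m k has_sum ramanujan_f (s * q ^ i) (s * q ^ j)) UNIV"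
proof -
  have main: "(theta_term q s m l has_sum ramanujan_f (s * q ^ i) (s * q ^ j)) UNIV"
    if l: "int i - int j = 2 * l" for l
  proof -
    have "theta_term q s m l summable_on UNIV"
      using assms l by (intro theta_term_summable) auto
    moreover have "ramanujan_f (s * q ^ i) (s * q ^ j) = (\<Sum>\<^sub>\<infinity>n. theta_term q s m l n)"
      unfolding ramanujan_f_def using ramanujan_f_term[OF q(2) s m l] by simp
    ultimately show ?thesis by simp
  qed
  show ?thesis
    using k
  proof
    assume "int j - int i = 2 * k"
    then have "(theta_term q s m (- k) has_sum ramanujan_f (s * q ^ i) (s * q ^ j)) UNIV"
      by (intro main) auto
    then show ?thesis
      by (subst has_sum_reindex_bij_witness[where i = uminus and j = uminus and T = UNIV
            and h = "theta_term q s m (- k)"])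
        (auto simp: theta_term_reflect[OF s])
  qed (rule main)
qed

section \<open>Dissections of the ternary lattice sum\<close>

definition lattice_term :: "complex \<Rightarrow> int \<times> int \<times> int \<Rightarrow> complex" where
  "lattice_term q = (\<lambda>(x, y, z).
     (- 1) powi (x + y + z) * q powi (2 * x\<^sup>2 + 2 * y\<^sup>2 + 3 * z\<^sup>2 - 2 * x * y - 2 * x * z))"

lemma lattice_term_has_sum_mod_7:
  assumes q: "q \<noteq> 0"
    and A: "(theta_term q (- 1) 7 (2 * (\<alpha> + 2 * \<beta>)) has_sum A) UNIV"
    and B: "(theta_term q (- 1) 7 (2 * (2 * \<alpha> - 3 * \<beta>)) has_sum B) UNIV"
    and C: "(theta_term q 1 7 (2 * (3 * \<alpha> - \<beta>)) has_sum C) UNIV"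
  shows "(lattice_term q has_sum
      ((- 1) powi (\<alpha> + \<beta>) * q powi (2 * \<alpha>\<^sup>2 + 2 * \<beta>\<^sup>2 - 2 * \<alpha> * \<beta>) * (A * (B * C))))
    {(x, y, z). (x + 2 * y + z) mod 7 = (\<alpha> + 2 * \<beta>) mod 7}" (is "(_ has_sum ?c * _) ?S")
proof -
  \<comment> \<open>With base point (\<open>\<alpha>\<close>, \<open>\<beta>\<close>, 0), the
    orthogonal coordinates of \<open>?g (a, b, c)\<close> are 7a + \<open>\<alpha>\<close> +
    2\<open>\<beta>\<close>, 7b + 2\<open>\<alpha>\<close> - 3\<open>\<beta>\<close> and 7c +
    3\<open>\<alpha>\<close> - \<open>\<beta>\<close>. The first one modulo 7 determines the
    class.\<close>
  let ?g = "\<lambda>(a, b, c). (2 * a + b + c + \<alpha>, 2 * a - b + \<beta>, a + b - c)"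
  let ?T = "\<lambda>(a, b, c). theta_term q (- 1) 7 (2 * (\<alpha> + 2 * \<beta>)) a *
      (theta_term q (- 1) 7 (2 * (2 * \<alpha> - 3 * \<beta>)) b * theta_term q 1 7 (2 * (3 * \<alpha> - \<beta>)) c)"
  have "(?T has_sum A * (B * C)) (UNIV \<times> UNIV \<times> UNIV)"
    using has_sum_mult_Times[OF A has_sum_mult_Times[OF B C]] by (simp add: case_prod_unfold)
  then have sum: "((\<lambda>p. ?c * ?T p) has_sum (?c * (A * (B * C)))) UNIV"
    by (intro has_sum_cmult_right) simp
  have bij: "bij_betw ?g UNIV ?S"
  proof (rule bij_betw_imageI)
    show "inj ?g" by (auto simp: inj_on_def)
    show "range ?g = ?S"
    proof (intro equalityI subsetI)
      fix p assume "p \<in> ?S"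
      then obtain x y z a where p: "p = (x, y, z)" and a: "x + 2 * y + z - (\<alpha> + 2 * \<beta>) = 7 * a"
        by (auto simp: mod_eq_dvd_iff elim: dvdE)
      have "p = ?g (a, 2 * a - (y - \<beta>), 3 * a - (y - \<beta>) - z)"
        using a by (simp add: p)
      then show "p \<in> range ?g" by blast
    qed (auto simp: mod_eq_dvd_iff algebra_simps)
  qed
  have "lattice_term q (?g p) = ?c * ?T p" for p
  proof -
    obtain a b c where p: "p = (a, b, c)" by (cases p)
    let ?X = "7 * a\<^sup>2 + 2 * (\<alpha> + 2 * \<beta>) * a" and ?Y = "7 * b\<^sup>2 + 2 * (2 * \<alpha> - 3 * \<beta>) * b"
      and ?Z = "7 * c\<^sup>2 + 2 * (3 * \<alpha> - \<beta>) * c" and ?W = "2 * \<alpha>\<^sup>2 + 2 * \<beta>\<^sup>2 - 2 * \<alpha> * \<beta>"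
    have "?c * ?T p = ((- 1) powi (\<alpha> + \<beta>) * (- 1) powi a * (- 1) powi b) *
        (q powi ?W * q powi ?X * q powi ?Y * q powi ?Z)"
      unfolding p theta_term_def by (simp only: power_int_1_left prod.case mult_1 mult_ac)
    also have "\<dots> = (- 1) powi (\<alpha> + \<beta> + a + b) * q powi (?W + ?X + ?Y + ?Z)"
      using q by (simp only: power_int_add simp_thms neg_equal_0_iff_equal one_neq_zero)
    \<comment> \<open>The coordinates of \<open>?g p\<close> add up to 5a + b +
      \<open>\<alpha>\<close> + \<open>\<beta>\<close>: c cancels, so the third theta series carries
      no sign.\<close>
    also have "(- 1 :: complex) powi (\<alpha> + \<beta> + a + b) = (- 1) powi (5 * a + b + \<alpha> + \<beta>)"
      by (rule sign_power_int_cong) auto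
    finally show ?thesis
      unfolding p lattice_term_def by (simp add: power2_eq_square algebra_simps)
  qed
  with sum have "((\<lambda>p. lattice_term q (?g p)) has_sum (?c * (A * (B * C)))) UNIV"
    by simp
  then show ?thesis
    by (simp only: has_sum_reindex_bij_betw[OF bij])
qed

lemma lattice_term_has_sum_mod_3:
  assumes q: "q \<noteq> 0"
    and A: "(theta_term q (- 1) 2 0 has_sum A) UNIV"
    and B: "(theta_term q (- 1) 6 (4 * r) has_sum B) UNIV"
    and C: "(theta_term q 1 21 (14 * r) has_sum C) UNIV"
  shows "(lattice_term q has_sum ((- 1) powi r * q powi (3 * r\<^sup>2) * (A * (B * C))))
    {(x, y, z). even (y + z) \<and> z mod 3 = r mod 3}" (is "(_ has_sum ?c * _) ?S")
proof -
  \<comment> \<open>This solves B = 3b + r and C = 3c + r for x, y, z, with u as the free first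
    coordinate; the squares then leave the constant 3r^2.\<close>
  let ?g = "\<lambda>(u, b, c). (u + b + 2 * c + r, 2 * b + c + r, r + 3 * c)"
  let ?T = "\<lambda>(u, b, c). theta_term q (- 1) 2 0 u *
      (theta_term q (- 1) 6 (4 * r) b * theta_term q 1 21 (14 * r) c)"
  have "(?T has_sum A * (B * C)) (UNIV \<times> UNIV \<times> UNIV)"
    using has_sum_mult_Times[OF A has_sum_mult_Times[OF B C]] by (simp add: case_prod_unfold)
  then have sum: "((\<lambda>p. ?c * ?T p) has_sum (?c * (A * (B * C)))) UNIV"
    by (intro has_sum_cmult_right) simp
  have bij: "bij_betw ?g UNIV ?S"
  proof (rule bij_betw_imageI)
    show "inj ?g" by (auto simp: inj_on_def)
    show "range ?g = ?S"
    proof (intro equalityI subsetI)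
      fix p assume "p \<in> ?S"
      then obtain x y z c where p: "p = (x, y, z)" and c: "z - r = 3 * c" and e: "even (y + z)"
        by (auto simp: mod_eq_dvd_iff elim: dvdE)
      have "even (y - c - r)" using c e by presburger
      then obtain b where b: "y - c - r = 2 * b" by (rule dvdE)
      have "p = ?g (x - b - 2 * c - r, b, c)"
        using b c by (simp add: p)
      then show "p \<in> range ?g" by blast
    qed (auto simp: mod_eq_dvd_iff)
  qed
  have "lattice_term q (?g p) = ?c * ?T p" for p
  proof -
    obtain u b c where p: "p = (u, b, c)" by (cases p)
    let ?X = "2 * u\<^sup>2 + 0 * u" and ?Y = "6 * b\<^sup>2 + 4 * r * b" and ?Z = "21 * c\<^sup>2 + 14 * r * c"
    have "?c * ?T p = ((- 1) powi r * (- 1) powi u * (- 1) powi b) *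
        (q powi (3 * r\<^sup>2) * q powi ?X * q powi ?Y * q powi ?Z)"
      unfolding p theta_term_def by (simp only: power_int_1_left prod.case mult_1 mult_ac)
    also have "\<dots> = (- 1) powi (r + u + b) * q powi (3 * r\<^sup>2 + ?X + ?Y + ?Z)"
      using q by (simp only: power_int_add simp_thms neg_equal_0_iff_equal one_neq_zero)
    also have "(- 1 :: complex) powi (r + u + b) = (- 1) powi (u + 3 * b + 6 * c + 3 * r)"
      by (rule sign_power_int_cong) auto
    finally show ?thesis
      unfolding p lattice_term_def by (simp add: power2_eq_square algebra_simps)
  qed
  with sum have "((\<lambda>p. lattice_term q (?g p)) has_sum (?c * (A * (B * C)))) UNIV"
    by simp
  then show ?thesis
    by (simp only: has_sum_reindex_bij_betw[OF bij])
qed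

text \<open>The sign-reversing reflection yields s = -s once a sum s exists, hence the summability
  assumption.\<close>

lemma lattice_term_has_sum_odd:
  assumes "lattice_term q summable_on {(x, y, z). odd (y + z)}" (is "_ summable_on ?S")
  shows "(lattice_term q has_sum 0) ?S"
proof -
  obtain s where s: "(lattice_term q has_sum s) ?S"
    using assms by (auto simp: summable_on_def)
  let ?h = "\<lambda>(x, y, z). (y + z - x, y, z :: int)"
  have "lattice_term q (?h p) = - lattice_term q p" if "p \<in> ?S" for p
    using that by (cases p)
      (auto simp: lattice_term_def power_int_minus_left power2_eq_square algebra_simps)
  then have "((\<lambda>p. - lattice_term q p) has_sum s) ?S \<longleftrightarrow> (lattice_term q has_sum s) ?S"
    by (intro has_sum_reindex_bij_witness[where i = ?h and j = ?h]) auto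
  with s have "(lattice_term q has_sum - s) ?S"
    by (simp add: has_sum_uminus)
  with s have "s = - s" by (rule has_sum_unique)
  with s show ?thesis by simp
qed

theorem corollary4p2:
  fixes q :: complex
  assumes "norm q < 1"
  shows
    "ramanujan_phi (- (q ^ 2)) * ramanujan_phi (- (q ^ 6)) * ramanujan_phi (q ^ 21)
       - 2 * q ^ 3 * ramanujan_phi (- (q ^ 2)) * ramanujan_f (- (q ^ 2)) (- (q ^ 10))
           * ramanujan_f (q ^ 7) (q ^ 35)
     = (ramanujan_phi (- (q ^ 7))) ^ 2 * ramanujan_phi (q ^ 7)
       - 2 * q ^ 2 * ramanujan_f (- (q ^ 3)) (- (q ^ 11)) * ramanujan_f (- q) (- (q ^ 13))
           * ramanujan_f (q ^ 5) (q ^ 9)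
       + 2 * q ^ 2 * ramanujan_f (- (q ^ 5)) (- (q ^ 9)) * ramanujan_f (- q) (- (q ^ 13))
           * ramanujan_f (q ^ 3) (q ^ 11)
       - 2 * q ^ 2 * ramanujan_f (- (q ^ 5)) (- (q ^ 9)) * ramanujan_f (- (q ^ 3)) (- (q ^ 11))
           * ramanujan_f q (q ^ 13)"
proof (cases "q = 0")
  \<comment> \<open>Adding integer exponents requires q to be nonzero; at q = 0 both sides are the
    cube of phi(0).\<close>
  case False
  note theta = theta_term_has_sum[OF assms False]
  let ?L = "ramanujan_phi (- (q ^ 2)) * (ramanujan_phi (- (q ^ 6)) * ramanujan_phi (q ^ 21))"
  let ?Q = "ramanujan_phi (- (q ^ 2)) * (ramanujan_f (- (q ^ 2)) (- (q ^ 10))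
           * ramanujan_f (q ^ 7) (q ^ 35))"
  \<comment> \<open>The index h of \<open>?N\<close> (alternating) and \<open>?P\<close> (unsigned)
    records the residues h and -h modulo 7, that is, the linear coefficients 2h and -2h.\<close>
  let ?N1 = "ramanujan_f (- (q ^ 5)) (- (q ^ 9))" and ?N2 = "ramanujan_f (- (q ^ 3)) (- (q ^ 11))"
    and ?N3 = "ramanujan_f (- q) (- (q ^ 13))" and ?P1 = "ramanujan_f (q ^ 5) (q ^ 9)"
    and ?P2 = "ramanujan_f (q ^ 3) (q ^ 11)" and ?P3 = "ramanujan_f q (q ^ 13)"
  let ?N0 = "ramanujan_phi (- (q ^ 7))" and ?P0 = "ramanujan_phi (q ^ 7)"
  have t7:
    "(theta_term q (- 1) 7 0 has_sum ?N0) UNIV" "(theta_term q 1 7 0 has_sum ?P0) UNIV"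
    "(theta_term q (- 1) 7 2 has_sum ?N1) UNIV" "(theta_term q (- 1) 7 (- 2) has_sum ?N1) UNIV"
    "(theta_term q (- 1) 7 4 has_sum ?N2) UNIV" "(theta_term q (- 1) 7 (- 4) has_sum ?N2) UNIV"
    "(theta_term q (- 1) 7 6 has_sum ?N3) UNIV" "(theta_term q (- 1) 7 (- 6) has_sum ?N3) UNIV"
    "(theta_term q 1 7 2 has_sum ?P1) UNIV" "(theta_term q 1 7 (- 2) has_sum ?P1) UNIV"
    "(theta_term q 1 7 4 has_sum ?P2) UNIV" "(theta_term q 1 7 (- 4) has_sum ?P2) UNIV"
    "(theta_term q 1 7 6 has_sum ?P3) UNIV" "(theta_term q 1 7 (- 6) has_sum ?P3) UNIV"
    unfolding ramanujan_phi_def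
    using theta[of "- 1" 7 7 7 0] theta[of 1 7 7 7 0]
      theta[of "- 1" 5 9 7 2] theta[of "- 1" 5 9 7 "- 2"] theta[of "- 1" 3 11 7 4]
      theta[of "- 1" 3 11 7 "- 4"] theta[of "- 1" 1 13 7 6] theta[of "- 1" 1 13 7 "- 6"]
      theta[of 1 5 9 7 2] theta[of 1 5 9 7 "- 2"] theta[of 1 3 11 7 4]
      theta[of 1 3 11 7 "- 4"] theta[of 1 1 13 7 6] theta[of 1 1 13 7 "- 6"]
    by simp_all
  have t3:
    "(theta_term q (- 1) 2 0 has_sum ramanujan_phi (- (q ^ 2))) UNIV"
    "(theta_term q (- 1) 6 0 has_sum ramanujan_phi (- (q ^ 6))) UNIV"
    "(theta_term q 1 21 0 has_sum ramanujan_phi (q ^ 21)) UNIV"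
    "(theta_term q (- 1) 6 4 has_sum ramanujan_f (- (q ^ 2)) (- (q ^ 10))) UNIV"
    "(theta_term q (- 1) 6 (- 4) has_sum ramanujan_f (- (q ^ 2)) (- (q ^ 10))) UNIV"
    "(theta_term q 1 21 14 has_sum ramanujan_f (q ^ 7) (q ^ 35)) UNIV"
    "(theta_term q 1 21 (- 14) has_sum ramanujan_f (q ^ 7) (q ^ 35)) UNIV"
    unfolding ramanujan_phi_def
    using theta[of "- 1" 2 2 2 0] theta[of "- 1" 6 6 6 0] theta[of 1 21 21 21 0]
      theta[of "- 1" 2 10 6 4] theta[of "- 1" 2 10 6 "- 4"]
      theta[of 1 7 35 21 14] theta[of 1 7 35 21 "- 14"]
    by simp_all

  let ?S = "\<lambda>i. {(x, y, z). (x + 2 * y + z) mod 7 = i} :: (int \<times> int \<times> int) set"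
  \<comment> \<open>Modulo 7 and up to signs, the multiples of (1, 2, 3) by 1, 2, 3 are (1, 2, 3),
    (2, 3, 1), (3, 1, 2), which gives the three mixed products. Classes i and 7 - i agree by
    negation, whence the factors 2.\<close>
  let ?s = "\<lambda>i :: int. if i = 0 then ?N0 * (?N0 * ?P0)
    else if i = 1 \<or> i = 6 then - (q\<^sup>2) * (?N1 * (?N2 * ?P3))
    else if i = 2 \<or> i = 5 then - (q\<^sup>2) * (?N2 * (?N3 * ?P1)) else q\<^sup>2 * (?N3 * (?N1 * ?P2))"
  let ?I = "{0, 1, 2, 3, 4, 5, 6} :: int set"
  note c7 = lattice_term_has_sum_mod_7[OF False]
  have "(lattice_term q has_sum sum ?s ?I) (\<Union>i\<in>?I. ?S i)"
  proof (rule sum_has_sum)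
    have "(lattice_term q has_sum ?s 0) (?S 0)"
      using c7[of 0 0, simplified, OF t7(1,1,2)] by simp
    moreover have "(lattice_term q has_sum ?s 1) (?S 1)"
      using c7[of 1 0, simplified, OF t7(3,5,13)] by simp
    moreover have "(lattice_term q has_sum ?s 2) (?S 2)"
      using c7[of 0 1, simplified, OF t7(5,8,10)] by simp
    moreover have "(lattice_term q has_sum ?s 3) (?S 3)"
      using c7[of 1 1, simplified, OF t7(7,4,11)] by simp
    moreover have "(lattice_term q has_sum ?s 4) (?S 4)"
      using c7[of "- 1" "- 1", simplified, OF t7(8,3,12)] by simp
    moreover have "(lattice_term q has_sum ?s 5) (?S 5)"
      using c7[of 0 "- 1", simplified, OF t7(6,7,9)] by simp
    moreover have "(lattice_term q has_sum ?s 6) (?S 6)"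
      using c7[of "- 1" 0, simplified, OF t7(4,6,14)] by simp
    ultimately show "(lattice_term q has_sum ?s i) (?S i)" if "i \<in> ?I" for i
      using that by blast
  qed auto
  also have "(\<Union>i\<in>?I. ?S i) = UNIV"
  proof -
    have "n mod 7 \<in> ?I" for n :: int
      using pos_mod_bound[of 7 n] pos_mod_sign[of 7 n] by auto
    then show ?thesis by blast
  qed
  finally have all: "(lattice_term q has_sum sum ?s ?I) UNIV" .

  let ?E = "{(x, y, z). even (y + z)} :: (int \<times> int \<times> int) set"
  let ?R = "\<lambda>i. {(x, y, z). even (y + z) \<and> z mod 3 = i} :: (int \<times> int \<times> int) set"
  let ?t = "\<lambda>i :: int. if i = 0 then ?L else - (q ^ 3) * ?Q"
  let ?J = "{0, 1, 2} :: int set"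
  note c3 = lattice_term_has_sum_mod_3[OF False t3(1)]
  have "(lattice_term q has_sum sum ?t ?J) (\<Union>i\<in>?J. ?R i)"
  proof (rule sum_has_sum)
    have "(lattice_term q has_sum ?t 0) (?R 0)"
      using c3[of 0, simplified, OF t3(2,3)] by simp
    moreover have "(lattice_term q has_sum ?t 1) (?R 1)"
      using c3[of 1, simplified, OF t3(4,6)] by simp
    \<comment> \<open>The representative -1 of the class 2 gives the same constant 3 and the same
      sign as r = 1, so this product occurs twice.\<close>
    moreover have "(lattice_term q has_sum ?t 2) (?R 2)"
      using c3[of "- 1", simplified, OF t3(5,7)] by simp
    ultimately show "(lattice_term q has_sum ?t i) (?R i)" if "i \<in> ?J" for i
      using that by blast
  qed auto
  also have "(\<Union>i\<in>?J. ?R i) = ?E"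
  proof -
    have "n mod 3 \<in> ?J" for n :: int
      using pos_mod_bound[of 3 n] pos_mod_sign[of 3 n] by auto
    then show ?thesis by blast
  qed
  finally have even: "(lattice_term q has_sum sum ?t ?J) ?E" .

  \<comment> \<open>The dissection modulo 7 has already established summability on the whole
    lattice.\<close>
  have "lattice_term q summable_on {(x, y, z). odd (y + z)}"
    using has_sum_imp_summable[OF all] by (rule summable_on_subset) auto
  from has_sum_Un_disjoint[OF even lattice_term_has_sum_odd[OF this]]
  have "(lattice_term q has_sum (sum ?t ?J + 0)) (?E \<union> {(x, y, z). odd (y + z)})"
    by auto
  also have "?E \<union> {(x, y, z). odd (y + z)} = UNIV"
    by auto
  finally have "sum ?t ?J + 0 = sum ?s ?I"
    using all has_sum_unique by blast
  then show ?thesis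
    by (simp add: algebra_simps power2_eq_square)
qed (simp add: power2_eq_square)

end
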